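(* Let $S=(s_n)_{n\ge1}$ be an increasing sequence of positive real numbers. Suppose $S$ can be written as a disjoint union $S=\bigcup_{k=1}^\infty S_k$ such that the following two conditions hold: (a) (Density condition) The relative upper density in $S$ of $R_K:=\bigcup_{k=1}^K S_k$ goes to $1$ as $K\to\infty$. (b) (Linear independence condition) Each subsequence $S_k$ of $S$ is linearly independent over $\mathbb Q$. Then $S$ is strong sweeping out.
   Context: The relative upper density in $S=(s_n)$ of a subsequence $B$ of $S$ is $\limsup_{N\to\infty}\frac{\#\{n\in\{1,\dots,N\}: s_n\in B\}}{N}$. A Lebesgue probability space $(X,\Sigma,\mu)$ is a complete, countably additive probability space that is measure-theoretically isomorphic to a measurable subset of the unit interval with Lebesgue measure. A flow $\{T^t:t\in\mathbb R\}$ is a group of measurable transformations $T^t:X\to X$ with $T^0(x)=x$ and $T^{t+s}=T^t\circ T^s$ for $s,t\in\mathbb R$. It is measurable if $(x,t)\mapsto T^t(x)$ from $X\times\mathbb R$ to $X$ is measurable with respect to the completion of the product of $\mu$ and Lebesgue measure on $\mathbb R$. It is measure preserving if it is measurable and $\mu((T^t)^{-1}A)=\mu(A)$ for all $A\in\Sigma$ and $t\in\mathbb R$. A dynamical system is a quadruple $(X,\Sigma,\mu,T^t)$ consisting of a Lebesgue probability space and a measure preserving flow on it. It is aperiodic if $\mu\{x: T^t(x)=T^s(x)\text{ for some }t\neq s\}=0$. A sequence $(s_n)$ of positive reals is strong sweeping out if in every aperiodic dynamical system $(X,\Sigma,\mu,T^t)$, for every $\epsilon>0$ there is a set $E\in\Sigma$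 with $\mu(E)<\epsilon$ such that $\limsup_{N\to\infty}\frac1N\sum_{n=1}^N\mathbf 1_E(T^{s_n}x)\ge 1$ for almost every $x\in X$, where $\mathbf 1_E$ is the indicator function of $E$. *)

theory Defs
  imports "HOL-Probability.Probability"
begin

text \<open>Sequences are indexed by the integers \<open>n \<ge> 1\<close>; the value at \<open>0\<close> is never used.\<close>

text \<open>A subsequence of an injective sequence is identified with the set of its values.\<close>

definition rel_upper_density :: "(nat \<Rightarrow> real) \<Rightarrow> real set \<Rightarrow> ereal" where
  "rel_upper_density s B =
     limsup (\<lambda>N. ereal (real (card {n \<in> {1..N}. s n \<in> B}) / real N))"

lemma vector_space_rat_real: "vector_space (\<lambda>(q::rat) (x::real). of_rat q * x)"
  by unfold_locales (auto simp: algebra_simps of_rat_add of_rat_mult)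

definition rat_independent :: "real set \<Rightarrow> bool" where
  "rat_independent A \<longleftrightarrow> module.independent (\<lambda>(q::rat) (x::real). of_rat q * x) A"

text \<open>
  Measure-theoretic isomorphism is, as usual, a bijection that is measurable and
  measure preserving in both directions after a null set is removed from each space.
\<close>

definition measure_isomorphic :: "'a measure \<Rightarrow> 'b measure \<Rightarrow> bool" where
  "measure_isomorphic M N \<longleftrightarrow>
     (\<exists>A \<in> null_sets M. \<exists>B \<in> null_sets N. \<exists>f.
        let M' = restrict_space M (space M - A);
            N' = restrict_space N (space N - B)
        in bij_betw f (space M') (space N')
           \<and> f \<in> measurable M' N'
           \<and> the_inv_into (space M') f \<in> measurable N' M'
           \<and> (\<forall>E \<in> sets N'. emeasure M' (f -` E \<inter> space M') = emeasure N' E))"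

locale lebesgue_prob_space = prob_space M + complete_measure M for M :: "'a measure" +
  assumes iso_unit_interval:
    "\<exists>Y \<in> sets lebesgue. Y \<subseteq> {0..1::real} \<and> measure_isomorphic M (lebesgue_on Y)"

locale dynamical_system = lebesgue_prob_space M for M :: "'a measure" +
  fixes T :: "real \<Rightarrow> 'a \<Rightarrow> 'a"
  assumes flow_measurable: "\<And>t. T t \<in> measurable M M"
    and flow_zero: "\<And>x. x \<in> space M \<Longrightarrow> T 0 x = x"
    and flow_add: "\<And>t s x. x \<in> space M \<Longrightarrow> T (t + s) x = T t (T s x)"
    and flow_jointly_measurable:
      "(\<lambda>(x, t). T t x) \<in> measurable (completion (M \<Otimes>\<^sub>M (lebesgue :: real measure))) M"
    and flow_measure_preserving:
      "\<And>t A. A \<in> sets M \<Longrightarrow> emeasure M (T t -` A \<inter> space M) = emeasure M A"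

locale aperiodic_dynamical_system = dynamical_system M T
  for M :: "'a measure" and T :: "real \<Rightarrow> 'a \<Rightarrow> 'a" +
  assumes aperiodic: "{x \<in> space M. \<exists>t s. t \<noteq> s \<and> T t x = T s x} \<in> null_sets M"

text \<open>
  HOL cannot quantify over types inside a formula, so the type of the points of the
  systems is a parameter; the notion for all systems is the one for arbitrary \<open>'a\<close>.
\<close>

definition strong_sweeping_out :: "'a itself \<Rightarrow> (nat \<Rightarrow> real) \<Rightarrow> bool" where
  "strong_sweeping_out _ s \<longleftrightarrow>
     (\<forall>(M :: 'a measure) T. aperiodic_dynamical_system M T \<longrightarrow>
        (\<forall>\<epsilon>>0. \<exists>E \<in> sets M. measure M E < \<epsilon> \<and>
           (AE x in M.
              limsup (\<lambda>N. ereal ((\<Sum>n=1..N. indicator E (T (s n) x)) / real N)) \<ge> 1)))"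

end

theory Submission
  imports Defs
begin

text \<open>
  Given finitely many terms of \<open>s\<close>, aperiodicity yields a function \<open>c\<close> (a clock) with
  \<open>c (T (s n) x) = c x + s n\<close> for these \<open>n\<close> outside a set of small measure. Fix \<open>K\<close> such that
  \<open>S 1, ..., S K\<close> together have upper density near \<open>1\<close>. By linear independence, for each
  \<open>k \<le> K\<close> there is an additive \<open>\<psi>\<^sub>k : \<real> \<rightarrow> \<real>\<close> with arbitrary prescribed integer values on
  \<open>S k\<close>; it turns the clock into a coordinate \<open>\<lfloor>\<psi>\<^sub>k (c x)\<rfloor>\<close> modulo \<open>Q\<close>. Let \<open>E\<close> be the set
  where some coordinate, suitably translated, is \<open>0\<close>, so that \<open>E\<close> has measure at most
  \<open>K / Q\<close>. The terms of \<open>s\<close> are cut into rapidly growing blocks, one for each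
  \<open>v \<in> (\<int>/Q)\<^sup>K\<close>, and \<open>\<psi>\<^sub>k\<close> is chosen to be \<open>- v\<^sub>k\<close> on the terms of \<open>S k\<close> in the block of \<open>v\<close>.
  Then a point with coordinates \<open>v\<close> is moved into \<open>E\<close> by almost every term of that block.
  Borel-Cantelli turns these finite stages into the full statement.
\<close>

section \<open>Boxes in finitely generated subgroups of the reals\<close>

text \<open>Balls around \<open>0\<close> in the group generated by \<open>D\<close>, as images of
  the cubes of radius \<open>r\<close> in the integer lattice. \<open>D\<close> may be rationally
  dependent, so one element can have several coefficient vectors. These balls measure distance along
  an orbit.\<close>

definition integer_box :: "real set \<Rightarrow> nat \<Rightarrow> real set" where
  "integer_box D r = (\<lambda>m. \<Sum>d\<in>D. of_int (m d) * d) ` (D \<rightarrow>\<^sub>E {- int r..int r})"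

lemma finite_integer_box: "finite D \<Longrightarrow> finite (integer_box D r)"
  unfolding integer_box_def by (intro finite_imageI finite_PiE) auto

lemma integer_box_iff:
  "g \<in> integer_box D r \<longleftrightarrow> (\<exists>m. (\<forall>d\<in>D. \<bar>m d\<bar> \<le> int r) \<and> g = (\<Sum>d\<in>D. of_int (m d) * d))"
proof
  assume "\<exists>m. (\<forall>d\<in>D. \<bar>m d\<bar> \<le> int r) \<and> g = (\<Sum>d\<in>D. of_int (m d) * d)"
  then obtain m where "\<forall>d\<in>D. \<bar>m d\<bar> \<le> int r" "g = (\<Sum>d\<in>D. of_int (m d) * d)"
    by blast
  then show "g \<in> integer_box D r"
    unfolding integer_box_def by (intro image_eqI[where x = "restrict m D"]) (auto simp: abs_le_iff)
next
  assume "g \<in> integer_box D r"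
  then obtain m where "m \<in> D \<rightarrow>\<^sub>E {- int r..int r}" "g = (\<Sum>d\<in>D. of_int (m d) * d)"
    unfolding integer_box_def by blast
  then show "\<exists>m. (\<forall>d\<in>D. \<bar>m d\<bar> \<le> int r) \<and> g = (\<Sum>d\<in>D. of_int (m d) * d)"
    by (intro exI[of _ m]) (simp add: PiE_iff abs_le_iff minus_le_iff)
qed

lemma integer_box_mono: "r \<le> q \<Longrightarrow> integer_box D r \<subseteq> integer_box D q"
proof -
  assume "r \<le> q"
  then have "\<bar>x\<bar> \<le> int q" if "\<bar>x\<bar> \<le> int r" for x
    using that by linarith
  then show ?thesis
    unfolding integer_box_iff subset_iff by blast
qed

lemma zero_in_integer_box: "0 \<in> integer_box D r"
  by (auto simp: integer_box_iff intro!: exI[where x = "\<lambda>_. 0"])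

lemma generator_in_integer_box:
  assumes "finite D" "d \<in> D"
  shows "d \<in> integer_box D 1"
proof -
  have "(\<Sum>x\<in>D. of_int (if x = d then 1 else 0) * x) = (\<Sum>x\<in>D. if x = d then x else 0)"
    by (rule sum.cong) auto
  then show ?thesis
    using assms unfolding integer_box_iff
    by (intro exI[of _ "\<lambda>x. if x = d then 1 else 0"]) simp
qed

lemma integer_box_uminus:
  assumes "g \<in> integer_box D r"
  shows "- g \<in> integer_box D r"
proof -
  from assms obtain m where "\<forall>d\<in>D. \<bar>m d\<bar> \<le> int r" "g = (\<Sum>d\<in>D. of_int (m d) * d)"
    unfolding integer_box_iff by blast
  then show ?thesis
    unfolding integer_box_iff by (intro exI[of _ "\<lambda>d. - m d"]) (simp add: sum_negf)
qed

lemma integer_box_add: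
  assumes "g \<in> integer_box D r" "h \<in> integer_box D q"
  shows "g + h \<in> integer_box D (r + q)"
proof -
  from assms obtain m m' where m: "\<forall>d\<in>D. \<bar>m d\<bar> \<le> int r" "g = (\<Sum>d\<in>D. of_int (m d) * d)"
    and m': "\<forall>d\<in>D. \<bar>m' d\<bar> \<le> int q" "h = (\<Sum>d\<in>D. of_int (m' d) * d)"
    unfolding integer_box_iff by blast
  have "\<bar>m d + m' d\<bar> \<le> int (r + q)" if "d \<in> D" for d
    using m(1)[rule_format, OF that] m'(1)[rule_format, OF that] by linarith
  moreover have "g + h = (\<Sum>d\<in>D. of_int (m d + m' d) * d)"
    by (simp add: m(2) m'(2) sum.distrib distrib_right)
  ultimately show ?thesis
    unfolding integer_box_iff by (intro exI[of _ "\<lambda>d. m d + m' d"]) blast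
qed

lemma integer_box_diff: "g \<in> integer_box D r \<Longrightarrow> h \<in> integer_box D q \<Longrightarrow> g - h \<in> integer_box D (r + q)"
  using integer_box_add[of g D r "- h" q] integer_box_uminus by simp

text \<open>A packing bound: the coefficient cube of radius \<open>2 * R\<close> splits into
  \<open>5 ^ card D\<close> cells, each holding at most one element of \<open>H\<close>. What
  matters is that the bound does not depend on \<open>R\<close>.\<close>

lemma card_separated_le:
  assumes D: "finite D" and R: "R > 0" and H: "H \<subseteq> integer_box D (2 * R)"
    and sep: "\<And>g h. g \<in> H \<Longrightarrow> h \<in> H \<Longrightarrow> g - h \<in> integer_box D R \<Longrightarrow> g = h"
  shows "card H \<le> 5 ^ card D"
proof -
  have "\<forall>g\<in>H. \<exists>m. (\<forall>d\<in>D. \<bar>m d\<bar> \<le> int (2 * R)) \<and> g = (\<Sum>d\<in>D. of_int (m d) * d)"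
    using H unfolding subset_iff integer_box_iff by blast
  from bchoice[OF this] obtain m where
    "\<forall>g\<in>H. (\<forall>d\<in>D. \<bar>m g d\<bar> \<le> int (2 * R)) \<and> g = (\<Sum>d\<in>D. of_int (m g d) * d)" ..
  then have m: "\<And>g d. g \<in> H \<Longrightarrow> d \<in> D \<Longrightarrow> \<bar>m g d\<bar> \<le> int (2 * R)"
    "\<And>g. g \<in> H \<Longrightarrow> g = (\<Sum>d\<in>D. of_int (m g d) * d)"
    by blast+
  \<comment> \<open>Two elements of the same cell differ by an element of the box of radius \<open>R\<close>.\<close>
  define cell where "cell g = (\<lambda>d\<in>D. m g d div int R)" for g
  have "inj_on cell H"
  proof (rule inj_onI)
    fix g h assume gh: "g \<in> H" "h \<in> H" and eq: "cell g = cell h"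
    have "\<bar>m g d - m h d\<bar> \<le> int R" if "d \<in> D" for d
    proof -
      have eq_div: "m g d div int R = m h d div int R"
        using fun_cong[OF eq, of d] that by (simp add: cell_def)
      have "m g d - m h d = m g d mod int R - m h d mod int R"
        using div_mult_mod_eq[of "m g d" "int R", unfolded eq_div] div_mult_mod_eq[of "m h d" "int R"]
        by linarith
      moreover have "0 \<le> m g d mod int R" "m g d mod int R < int R"
        "0 \<le> m h d mod int R" "m h d mod int R < int R"
        using R by auto
      ultimately show ?thesis by linarith
    qed
    moreover have "g - h = (\<Sum>d\<in>D. of_int (m g d - m h d) * d)"
      by (subst m(2)[OF gh(1)], subst m(2)[OF gh(2)]) (simp add: sum_subtractf left_diff_distrib)
    ultimately have "g - h \<in> integer_box D R"
      unfolding integer_box_iff by (intro exI[of _ "\<lambda>d. m g d - m h d"] conjI ballI)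
    with gh sep show "g = h" by blast
  qed
  \<comment> \<open>Five values occur for each coordinate because the endpoint \<open>2 * R\<close>
    is allowed and has quotient \<open>2\<close>.\<close>
  moreover have "cell ` H \<subseteq> D \<rightarrow>\<^sub>E {-2..2::int}"
  proof -
    have "m g d div int R \<in> {-2..2}" if "g \<in> H" "d \<in> D" for g d
    proof -
      have "- 2 * int R \<le> m g d" "m g d \<le> 2 * int R"
        using m(1)[OF that] by linarith+
      then have "(- 2 * int R) div int R \<le> m g d div int R"
          "m g d div int R \<le> (2 * int R) div int R"
        using R by (simp_all only: zdiv_mono1 of_nat_0_less_iff)
      moreover have "(- 2 * int R) div int R = - 2" "(2 * int R) div int R = 2"
        using R by (simp_all only: nonzero_mult_div_cancel_right of_nat_eq_0_iff)
      ultimately show ?thesis by simp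
    qed
    then show ?thesis by (auto simp: cell_def)
  qed
  ultimately have "card H \<le> card (D \<rightarrow>\<^sub>E {-2..2::int})"
    using D by (intro card_inj_on_le[where f = cell]) (auto intro!: finite_PiE)
  then show ?thesis using D by (simp add: card_PiE)
qed

text \<open>Independence over the rationals lets any values on \<open>A\<close> extend to a
  rational-linear map, which is in particular additive. Such a map may fail to be
  measurable.\<close>

lemma rat_independent_additive_extension:
  assumes "rat_independent A"
  shows "\<exists>g :: real \<Rightarrow> real. (\<forall>x y. g (x + y) = g x + g y) \<and> (\<forall>x\<in>A. g x = f x)"
proof -
  interpret vector_space_pair "\<lambda>(q::rat) (x::real). of_rat q * x" "\<lambda>(q::rat) (x::real). of_rat q * x"
    using vector_space_rat_real by (simp add: vector_space_pair_def)
  obtain g where g: "Vector_Spaces.linear (\<lambda>(q::rat) (x::real). of_rat q * x) (\<lambda>(q::rat) (x::real). of_rat q * x) g"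
    "\<forall>x\<in>A. g x = f x"
    using linear_independent_extend assms unfolding rat_independent_def by blast
  interpret g: Vector_Spaces.linear "\<lambda>(q::rat) (x::real). of_rat q * x" "\<lambda>(q::rat) (x::real). of_rat q * x" g
    by (rule g(1))
  show ?thesis using g.add g(2) by blast
qed

section \<open>Markers and clocks for aperiodic flows\<close>

context dynamical_system
begin

lemma flow_in_space: "x \<in> space M \<Longrightarrow> T t x \<in> space M"
  by (rule measurable_space[OF flow_measurable])

lemma flow_flow: "x \<in> space M \<Longrightarrow> T t (T s x) = T (t + s) x"
  by (simp add: flow_add)

lemma flow_vimage_sets: "A \<in> sets M \<Longrightarrow> T t -` A \<inter> space M \<in> sets M"
  by (rule measurable_sets[OF flow_measurable])

lemma measure_flow_vimage: "A \<in> sets M \<Longrightarrow> measure M (T t -` A \<inter> space M) = measure M A"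
  by (simp add: measure_def flow_measure_preserving)

lemma distr_flow: "distr M M (T t) = M"
  by (rule measure_eqI) (simp_all add: emeasure_distr flow_measurable flow_measure_preserving)

lemma AE_flow:
  assumes "AE x in M. P x"
  shows "AE x in M. P (T t x)"
proof -
  have "AE x in distr M M (T t). P x" by (subst distr_flow) (rule assms)
  then show ?thesis by (rule AE_distrD[OF flow_measurable])
qed

text \<open>The isomorphism with a subset of the unit interval supplies a real coordinate that
  distinguishes almost all points. This is where the Lebesgue space assumption enters.\<close>

lemma separating_function:
  obtains h :: "'a \<Rightarrow> real" and Z where "h \<in> borel_measurable M" "Z \<in> null_sets M"
    "inj_on h (space M - Z)"
proof -
  obtain Y where Y: "Y \<in> sets lebesgue" "Y \<subseteq> {0..1::real}" "measure_isomorphic M (lebesgue_on Y)"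
    using iso_unit_interval by blast
  obtain A B f where A: "A \<in> null_sets M"
    and f: "bij_betw f (space (restrict_space M (space M - A)))
                (space (restrict_space (lebesgue_on Y) (space (lebesgue_on Y) - B)))"
      "f \<in> measurable (restrict_space M (space M - A))
               (restrict_space (lebesgue_on Y) (space (lebesgue_on Y) - B))"
    using Y(3) unfolding measure_isomorphic_def Let_def by blast
  \<comment> \<open>Extension by a constant over the removed null set keeps the function measurable
    on the whole space.\<close>
  define h where "h x = (if x \<in> space M - A then f x else 0)" for x
  have "f \<in> borel_measurable (restrict_space M (space M - A))"
  proof -
    have "f \<in> measurable (restrict_space M (space M - A)) (lebesgue_on Y)"
      using f(2) by (simp add: measurable_restrict_space2_iff)
    then have "f \<in> measurable (restrict_space M (space M - A)) lebesgue"
      by (simp add: measurable_restrict_space2_iff)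
    then show ?thesis
      using measurable_comp[of f _ lebesgue "\<lambda>x. x" borel] by (simp add: comp_def measurable_completion)
  qed
  moreover have "(space M - A) \<inter> space M \<in> sets M" using A by auto
  ultimately have "h \<in> borel_measurable M"
    unfolding h_def by (subst (asm) measurable_restrict_space_iff[where c = 0]) auto
  moreover have "inj_on h (space M - A)"
    using f(1) by (auto simp: bij_betw_def inj_on_def h_def space_restrict_space)
  ultimately show thesis using that A by blast
qed

end

context aperiodic_dynamical_system
begin

lemma AE_free: "AE x in M. \<forall>t s. T t x = T s x \<longrightarrow> t = s"
  by (rule AE_I'[OF aperiodic]) auto

text \<open>On a free orbit the finitely many points \<open>T g x\<close> with nonzero
  \<open>g\<close> in \<open>F\<close> differ from \<open>x\<close>, and so do their
  \<open>h\<close>-values. Hence some set of a countable base contains \<open>h x\<close> and none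
  of the others; the sets \<open>B i\<close> collect the points for which the \<open>i\<close>-th
  base set does this.\<close>

lemma displacing_cover:
  assumes F: "finite F"
  obtains B :: "nat \<Rightarrow> 'a set"
  where "\<And>i. B i \<in> sets M"
    and "\<And>i g x. x \<in> B i \<Longrightarrow> T g x \<in> B i \<Longrightarrow> g \<in> F \<Longrightarrow> g = 0"
    and "AE x in M. \<exists>i. x \<in> B i"
proof -
  obtain h :: "'a \<Rightarrow> real" and Z where h: "h \<in> borel_measurable M" and Z: "Z \<in> null_sets M"
    and inj: "inj_on h (space M - Z)"
    using separating_function by blast
  obtain U :: "nat \<Rightarrow> real set" where U: "\<And>i. open (U i)"
    "\<And>x S. open S \<Longrightarrow> x \<in> S \<Longrightarrow> \<exists>i. x \<in> U i \<and> U i \<subseteq> S"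
  proof -
    obtain \<U> :: "real set set" where \<U>: "countable \<U>" "topological_basis \<U>"
      using ex_countable_basis by blast
    have ne: "\<U> \<noteq> {}"
      using topological_basisE[OF \<U>(2) open_UNIV UNIV_I] by blast
    show thesis
    proof (rule that[of "from_nat_into \<U>"])
      show "open (from_nat_into \<U> i)" for i
        using from_nat_into[OF ne] topological_basis_open[OF \<U>(2)] by blast
      show "\<exists>i. x \<in> from_nat_into \<U> i \<and> from_nat_into \<U> i \<subseteq> S" if "open S" "x \<in> S" for x S
        using topological_basisE[OF \<U>(2) that] from_nat_into_surj[OF \<U>(1)] by metis
    qed
  qed
  define B where
    "B i = {x \<in> space M. h x \<in> U i \<and> (\<forall>g\<in>F - {0}. h (T g x) \<notin> U i)}" for i
  show thesis
  proof (rule that[of B])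
    fix i
    have "(\<lambda>x. h (T g x)) -` U i \<inter> space M \<in> sets M" for g
      by (rule measurable_sets[OF measurable_compose[OF flow_measurable h] borel_open[OF U(1)]])
    moreover have "h -` U i \<inter> space M \<in> sets M"
      by (rule measurable_sets[OF h borel_open[OF U(1)]])
    ultimately have "(h -` U i \<inter> space M) - (\<Union>g\<in>F - {0}. (\<lambda>x. h (T g x)) -` U i \<inter> space M) \<in> sets M"
      using F by (intro sets.Diff sets.finite_UN) auto
    also have "(h -` U i \<inter> space M) - (\<Union>g\<in>F - {0}. (\<lambda>x. h (T g x)) -` U i \<inter> space M) = B i"
      by (auto simp: B_def)
    finally show "B i \<in> sets M" .
  next
    show "g = 0" if "x \<in> B i" "T g x \<in> B i" "g \<in> F" for i g x
      using that by (auto simp: B_def)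
  next
    \<comment> \<open>The flow preserves null sets, so almost every point has all the relevant
      translates in the set where \<open>h\<close> is injective.\<close>
    have "AE x in M. x \<in> space M - Z"
      using AE_not_in[OF Z] AE_space by eventually_elim auto
    then have "AE x in M. T g x \<in> space M - Z" for g by (rule AE_flow)
    then have "AE x in M. \<forall>g\<in>insert 0 F. T g x \<in> space M - Z"
      using F by (simp add: AE_ball_countable uncountable_infinite countable_finite)
    then show "AE x in M. \<exists>i. x \<in> B i"
      using AE_free AE_space
    proof eventually_elim
      case (elim x)
      let ?V = "- (\<lambda>g. h (T g x)) ` (F - {0})"
      have "T 0 x = x" using elim(3) by (rule flow_zero)
      moreover have "h (T g x) \<noteq> h (T 0 x)" if "g \<in> F - {0}" for g
        using that elim(1,2) inj_onD[OF inj, of "T g x" "T 0 x"] by auto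
      ultimately have "h x \<in> ?V" by force
      moreover have "open ?V" using F by (intro open_Compl finite_imp_closed) auto
      ultimately obtain i where "h x \<in> U i" "U i \<subseteq> ?V" using U(2) by blast
      then show ?case using elim(3) by (auto simp: B_def)
    qed
  qed
qed

text \<open>Greedy choice: the sets \<open>B i\<close> are visited in order, and a point is kept
  unless a marker chosen earlier lies within \<open>R\<close>. This yields both separation and
  covering. The radius \<open>4 * R\<close> within one \<open>A i\<close> ensures that a point sees
  at most one marker of each index within distance \<open>2 * R\<close>.\<close>

lemma markers:
  assumes D: "finite D"
  obtains A :: "nat \<Rightarrow> 'a set"
  where "\<And>i. A i \<in> sets M"
    and "\<And>i g x. x \<in> A i \<Longrightarrow> T g x \<in> A i \<Longrightarrow> g \<in> integer_box D (4 * R) \<Longrightarrow> g = 0"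
    and "\<And>i j g x. x \<in> A i \<Longrightarrow> T g x \<in> A j \<Longrightarrow> g \<in> integer_box D R \<Longrightarrow> g = 0"
    and "AE x in M. \<exists>g\<in>integer_box D R. \<exists>i. T g x \<in> A i"
proof -
  obtain B :: "nat \<Rightarrow> 'a set" where B: "\<And>i. B i \<in> sets M"
    "\<And>i g x. x \<in> B i \<Longrightarrow> T g x \<in> B i \<Longrightarrow> g \<in> integer_box D (4 * R) \<Longrightarrow> g = 0"
    "AE x in M. \<exists>i. x \<in> B i"
    using displacing_cover[OF finite_integer_box[OF D]] by blast
  define C where "C = rec_nat {} (\<lambda>i C. C \<union> {x \<in> B i. \<forall>g\<in>integer_box D R. T g x \<notin> C})"
  define A where "A i = {x \<in> B i. \<forall>g\<in>integer_box D R. T g x \<notin> C i}" for i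
  have C_simps: "C 0 = {}" "C (Suc i) = C i \<union> A i" for i
    by (simp_all add: C_def A_def)
  have C: "C i = (\<Union>j<i. A j)" for i
    by (induction i) (auto simp: C_simps less_Suc_eq)
  have A_sets': "A i \<in> sets M" if "C i \<in> sets M" for i
  proof -
    have "A i = B i - (\<Union>g\<in>integer_box D R. T g -` C i \<inter> space M)"
      using sets.sets_into_space[OF B(1)] by (auto simp: A_def)
    moreover have "(\<Union>g\<in>integer_box D R. T g -` C i \<inter> space M) \<in> sets M"
      using flow_vimage_sets[OF that] finite_integer_box[OF D] by (intro sets.finite_UN) auto
    ultimately show ?thesis using B(1) by (simp only: sets.Diff)
  qed
  have C_sets: "C i \<in> sets M" for i
    by (induction i) (auto simp: C_simps A_sets')
  note A_sets = A_sets'[OF C_sets]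
  have A_space: "x \<in> space M" if "x \<in> A i" for x i
    using sets.sets_into_space[OF A_sets] that by blast
  have same: "g = 0" if "x \<in> A i" "T g x \<in> A i" "g \<in> integer_box D (4 * R)" for x g i
    using that B(2) by (auto simp: A_def)
  have box_le: "integer_box D R \<subseteq> integer_box D (4 * R)" by (rule integer_box_mono) simp
  show thesis
  proof (rule that[of A])
    show "A i \<in> sets M" for i by (rule A_sets)
    show "g = 0" if "x \<in> A i" "T g x \<in> A i" "g \<in> integer_box D (4 * R)" for x g i
      using same that .
    show "g = 0" if *: "x \<in> A i" "T g x \<in> A j" "g \<in> integer_box D R" for x g i j
    proof (cases i j rule: linorder_cases)
      case less
      \<comment> \<open>Here \<open>x\<close> is the earlier marker, so the rule of choice is
        applied at \<open>T g x\<close>, from which \<open>- g\<close> leads back to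
        \<open>x\<close>.\<close>
      then have "x \<in> C j" using * by (auto simp: C)
      moreover have "T (- g) (T g x) = x"
        using A_space[OF *(1)] by (simp add: flow_flow flow_zero)
      ultimately show ?thesis
        using *(2) integer_box_uminus[OF *(3)] by (auto simp: A_def)
    next
      case equal
      then show ?thesis using * same box_le by blast
    next
      case greater
      then have "T g x \<in> C i" using * by (auto simp: C)
      then show ?thesis using * by (auto simp: A_def)
    qed
    show "AE x in M. \<exists>g\<in>integer_box D R. \<exists>i. T g x \<in> A i"
      using B(3) AE_space
    proof eventually_elim
      case (elim x)
      then obtain i where i: "x \<in> B i" by blast
      show ?case
      proof (cases "x \<in> A i")
        case True
        moreover have "T 0 x = x" using elim by (simp add: flow_zero)
        ultimately show ?thesis
          using zero_in_integer_box[of D R] by (intro bexI[of _ 0] exI[of _ i]) simp_all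
      next
        case False
        with i obtain g where "g \<in> integer_box D R" "T g x \<in> C i" by (auto simp: A_def)
        then show ?thesis by (auto simp: C)
      qed
    qed
  qed
qed

text \<open>
  A point is assigned to the marker of least index within distance \<open>r\<close>, and the clock is the
  time elapsed since that marker. A generator can change the assigned marker only if some
  marker lies at distance exactly \<open>r\<close>. As at most \<open>5 ^ card D\<close> markers are within distance
  \<open>2 * R\<close> of a point, this is rare for some radius \<open>r\<close> between \<open>R\<close> and \<open>2 * R\<close>.
\<close>

lemma approximate_clock:
  assumes D: "finite D" and "\<eta> > 0"
  obtains c :: "'a \<Rightarrow> real" where "simple_function M c"
    and "measure M {x \<in> space M. \<exists>d\<in>D. c (T d x) \<noteq> c x + d} < \<eta>"
proof -
  define C :: real where "C = 5 ^ card D"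
  \<comment> \<open>The exceptional set will be covered by \<open>card D + 1\<close> translates of
    one set of measure at most \<open>C / R\<close>.\<close>
  obtain R :: nat where R: "(card D + 1) * C / \<eta> < R"
    using reals_Archimedean2 by blast
  have "C > 0" by (simp add: C_def)
  have "0 \<le> (card D + 1) * C / \<eta>" using \<open>\<eta> > 0\<close> \<open>C > 0\<close> by simp
  with R have R0: "R > 0" by linarith
  obtain A :: "nat \<Rightarrow> 'a set" where A: "\<And>i. A i \<in> sets M"
    and A_same: "\<And>i g x. x \<in> A i \<Longrightarrow> T g x \<in> A i \<Longrightarrow> g \<in> integer_box D (4 * R) \<Longrightarrow> g = 0"
    and A_sep: "\<And>i j g x. x \<in> A i \<Longrightarrow> T g x \<in> A j \<Longrightarrow> g \<in> integer_box D R \<Longrightarrow> g = 0"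
    and A_cover: "AE x in M. \<exists>g\<in>integer_box D R. \<exists>i. T g x \<in> A i"
    by (rule markers[OF D, of R], rule that)
  have mark_sets: "T g -` A i \<inter> space M \<in> sets M" for g i
    using A by (rule flow_vimage_sets)

  \<comment> \<open>The points that see a marker at distance exactly \<open>r\<close>.\<close>
  define V where "V r = (\<Union>g\<in>integer_box D r - integer_box D (r - 1). \<Union>i. T g -` A i \<inter> space M)" for r
  have V_sets: "V r \<in> sets M" for r
    unfolding V_def using mark_sets finite_integer_box[OF D]
    by (intro sets.countable_UN') (auto simp: countable_finite simp del: UN_simps)
  have card_V: "card {r \<in> {R<..2 * R}. x \<in> V r} \<le> 5 ^ card D" if x: "x \<in> space M" for x
  proof -
    \<comment> \<open>Markers at different distances are different.\<close>
    define I where "I = {r \<in> {R<..2 * R}. x \<in> V r}"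
    have "\<forall>r\<in>I. \<exists>g. g \<in> integer_box D r \<and> g \<notin> integer_box D (r - 1) \<and> (\<exists>i. T g x \<in> A i)"
      by (auto simp: I_def V_def)
    from bchoice[OF this] obtain g where g: "\<And>r. r \<in> I \<Longrightarrow> g r \<in> integer_box D r"
      "\<And>r. r \<in> I \<Longrightarrow> g r \<notin> integer_box D (r - 1)" "\<And>r. r \<in> I \<Longrightarrow> \<exists>i. T (g r) x \<in> A i"
      by blast
    have neq: "g r \<noteq> g q" if "r \<in> I" "q \<in> I" "r < q" for r q
    proof -
      from that(3) have "r \<le> q - 1" by linarith
      then show ?thesis
        using integer_box_mono[of r "q - 1" D] g(1)[OF that(1)] g(2)[OF that(2)] by (metis subsetD)
    qed
    have "inj_on g I"
    proof (rule inj_onI)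
      fix r q assume "r \<in> I" "q \<in> I" "g r = g q"
      then show "r = q" using neq[of r q] neq[of q r] by (cases r q rule: linorder_cases) auto
    qed
    moreover have "card (g ` I) \<le> 5 ^ card D"
    proof (rule card_separated_le[OF D R0])
      show "g ` I \<subseteq> integer_box D (2 * R)"
        using g(1) integer_box_mono[of _ "2 * R" D] by (fastforce simp: I_def)
      fix a b assume ab: "a \<in> g ` I" "b \<in> g ` I" "a - b \<in> integer_box D R"
      obtain i j where "T a x \<in> A i" "T b x \<in> A j" using ab(1,2) g(3) by blast
      moreover have "T (a - b) (T b x) = T a x" using x by (simp add: flow_flow)
      ultimately have "a - b = 0" using A_sep[of "T b x" j "a - b" i] ab(3) by simp
      then show "a = b" by simp
    qed
    ultimately show ?thesis by (simp add: card_image I_def)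
  qed
  \<comment> \<open>Integrating the number of radii that are bad at a point bounds the sum of all
    \<open>R\<close> measures by \<open>C\<close>; some radius is then at most the average
    \<open>C / R\<close>.\<close>
  have "(\<Sum>r\<in>{R<..2 * R}. measure M (V r)) = (\<integral>x. (\<Sum>r\<in>{R<..2 * R}. indicator (V r) x) \<partial>M)"
    using V_sets sets.sets_into_space[OF V_sets]
    by (subst Bochner_Integration.integral_sum) (auto simp: Int_absorb2 emeasure_eq_measure intro!: sum.cong)
  also have "\<dots> \<le> C"
  proof (rule integral_le_const)
    show "integrable M (\<lambda>x. \<Sum>r\<in>{R<..2 * R}. indicator (V r) x :: real)"
      using V_sets by (intro Bochner_Integration.integrable_sum) (auto simp: emeasure_eq_measure)
    have "(\<Sum>r\<in>{R<..2 * R}. indicator (V r) x) \<le> C" if "x \<in> space M" for x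
    proof -
      have "(\<Sum>r\<in>{R<..2 * R}. indicator (V r) x :: real) = card {r \<in> {R<..2 * R}. x \<in> V r}"
        by (simp add: indicator_def sum.If_cases Int_def)
      then show ?thesis
        using card_V[OF that] by (simp add: C_def)
    qed
    then show "AE x in M. (\<Sum>r\<in>{R<..2 * R}. indicator (V r) x) \<le> C"
      by (rule AE_I2)
  qed
  finally have sum_V: "(\<Sum>r\<in>{R<..2 * R}. measure M (V r)) \<le> C" .
  obtain r where r: "R < r" "r \<le> 2 * R" "measure M (V r) \<le> C / R"
  proof (rule ccontr)
    assume "\<not> thesis"
    with that have "\<forall>r\<in>{R<..2 * R}. C / R < measure M (V r)" by force
    then have "(\<Sum>r\<in>{R<..2 * R}. C / R) < (\<Sum>r\<in>{R<..2 * R}. measure M (V r))"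
      using R0 by (intro sum_strict_mono) auto
    with sum_V R0 show False by simp
  qed

  define first where "first g i x \<longleftrightarrow> g \<in> integer_box D r \<and> T g x \<in> A i \<and>
      (\<forall>j<i. \<forall>h\<in>integer_box D r. T h x \<notin> A j)" for g i x
  define W where "W g = {x \<in> space M. \<exists>i. first g i x}" for g
  \<comment> \<open>If the assigned marker is \<open>T g x\<close>, then \<open>x\<close> is reached
    from it in time \<open>- g\<close>. Written as a finite sum over shifts, the clock is visibly a
    simple function.\<close>
  define c :: "'a \<Rightarrow> real" where "c x = (\<Sum>g\<in>integer_box D r. - g * indicator (W g) x)" for x
  have W_sets: "W g \<in> sets M" for g
  proof (cases "g \<in> integer_box D r")
    case True
    then have "W g = (\<Union>i. (T g -` A i \<inter> space M) -
        (\<Union>j\<in>{..<i}. \<Union>h\<in>integer_box D r. T h -` A j \<inter> space M))"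
      by (auto simp: W_def first_def)
    also have "\<dots> \<in> sets M"
      using finite_integer_box[OF D] mark_sets
      by (auto intro!: sets.countable_UN' sets.Diff simp: countable_finite simp del: UN_simps)
    finally show ?thesis .
  qed (simp add: W_def first_def)
  have c_simple: "simple_function M c"
    unfolding c_def using W_sets
    by (intro simple_function_sum simple_function_mult simple_function_const simple_function_indicator)
  \<comment> \<open>Two shifts of size at most \<open>r\<close> differ by at most
    \<open>2 * r\<close>, hence by at most \<open>4 * R\<close>.\<close>
  have same_index: "g = h" if x: "x \<in> space M" and gh: "g \<in> integer_box D r" "h \<in> integer_box D r"
      and A: "T g x \<in> A i" "T h x \<in> A i" for g h i x
  proof -
    have "h - g \<in> integer_box D (4 * R)"
      using integer_box_diff[OF gh(2,1)] integer_box_mono[of "r + r" "4 * R" D] r(2) by auto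
    moreover have "T (h - g) (T g x) \<in> A i" using A(2) x by (simp add: flow_flow)
    ultimately have "h - g = 0" using A_same A(1) by blast
    then show ?thesis by simp
  qed
  have first_unique: "g = h \<and> i = j" if x: "x \<in> space M" and "first g i x" "first h j x" for g h i j x
  proof -
    have "i = j" using that(2,3) by (cases i j rule: linorder_cases) (auto simp: first_def)
    with that same_index show ?thesis unfolding first_def by blast
  qed
  have c_eq: "c x = - g" if x: "x \<in> space M" and g: "first g i x" for g i x
  proof -
    have "x \<in> W h \<longleftrightarrow> h = g" for h
      using x g first_unique[OF x g] unfolding W_def by blast
    then have "c x = (\<Sum>h\<in>integer_box D r. if h = g then - g else 0)"
      unfolding c_def by (intro sum.cong) (simp_all add: indicator_def)
    also have "\<dots> = - g"
      using g finite_integer_box[OF D] by (simp add: first_def)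
    finally show ?thesis .
  qed
  have ex_first: "\<exists>g i. first g i x" if "\<exists>g\<in>integer_box D R. \<exists>i. T g x \<in> A i" for x
  proof -
    have "\<exists>i. \<exists>g\<in>integer_box D r. T g x \<in> A i"
      using that integer_box_mono[of R r D] r(1) by fastforce
    then obtain i where "\<exists>g\<in>integer_box D r. T g x \<in> A i"
        "\<forall>j<i. \<not> (\<exists>g\<in>integer_box D r. T g x \<in> A j)"
      using exists_least_iff[of "\<lambda>i. \<exists>g\<in>integer_box D r. T g x \<in> A i"] by blast
    then show ?thesis unfolding first_def by blast
  qed
  \<comment> \<open>One generator changes the distance by at most \<open>1\<close>, so a marker can
    leave the ball of radius \<open>r\<close> only from its outermost shell.\<close>
  have in_V: "x \<in> V r" if "x \<in> space M" "first g i x" "g + d \<notin> integer_box D r"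
      "d \<in> D \<or> - d \<in> D" for x g i d
  proof -
    have "d \<in> integer_box D 1"
      using that(4) generator_in_integer_box[OF D] integer_box_uminus[of "- d" D 1] by auto
    then have "g \<notin> integer_box D (r - 1)"
      using integer_box_add[of g D "r - 1" d 1] that(3) r(1) by auto
    then show ?thesis using that(1,2) by (auto simp: V_def first_def)
  qed
  define U where "U = V r \<union> (\<Union>d\<in>D. T d -` V r \<inter> space M)"
  \<comment> \<open>Off \<open>U\<close>, the assigned marker of each of \<open>x\<close> and
    \<open>T d x\<close> is also within \<open>r\<close> of the other point. By minimality the two
    indices agree, so the marker is the same and \<open>h = g - d\<close>.\<close>
  have clock: "c (T d x) = c x + d"
    if x: "x \<in> space M" and d: "d \<in> D" and U: "x \<notin> U"
      and f: "first g i x" "first h j (T d x)" for x d g h i j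
  proof -
    note y = flow_in_space[OF x, of d]
    have 1: "g - d \<in> integer_box D r"
      using in_V[OF x f(1), of "- d"] U d by (auto simp: U_def)
    have 2: "h + d \<in> integer_box D r"
      using in_V[OF y f(2), of d] U d x by (auto simp: U_def)
    have 3: "T (g - d) (T d x) = T g x" "T h (T d x) = T (h + d) x"
      using x by (simp_all add: flow_flow)
    have "\<not> i < j" using f 1 3 unfolding first_def by metis
    moreover have "\<not> j < i" using f 2 3 unfolding first_def by metis
    ultimately have "i = j" by simp
    then have "g - d = h"
      using same_index[OF y 1, of h i] f 3 unfolding first_def by metis
    then show ?thesis using c_eq[OF x f(1)] c_eq[OF y f(2)] by simp
  qed
  have U_sets: "U \<in> sets M"
    unfolding U_def using V_sets flow_vimage_sets[OF V_sets] D by (intro sets.Un sets.finite_UN) auto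
  \<comment> \<open>The element \<open>0\<close> is inserted to cover \<open>x\<close> itself along
    with its translates.\<close>
  have "AE x in M. \<forall>d\<in>insert 0 D. \<exists>g\<in>integer_box D R. \<exists>i. T g (T d x) \<in> A i"
    using D AE_flow[OF A_cover] by (intro AE_finite_allI) auto
  then have "AE x in M. x \<in> {x \<in> space M. \<exists>d\<in>D. c (T d x) \<noteq> c x + d} \<longrightarrow> x \<in> U"
    using AE_space
  proof eventually_elim
    case (elim x)
    have "\<exists>g\<in>integer_box D R. \<exists>i. T g (T 0 x) \<in> A i" using elim(1) by blast
    then obtain g i where g: "first g i x" using ex_first elim(2) by (metis flow_zero)
    show ?case
    proof (intro impI, rule ccontr)
      assume "x \<in> {x \<in> space M. \<exists>d\<in>D. c (T d x) \<noteq> c x + d}" and "x \<notin> U"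
      then obtain d where d: "d \<in> D" "c (T d x) \<noteq> c x + d" by blast
      then obtain h j where "first h j (T d x)" using ex_first elim(1) by blast
      then show False using clock[OF elim(2) d(1) \<open>x \<notin> U\<close> g] d(2) by blast
    qed
  qed
  then have "measure M {x \<in> space M. \<exists>d\<in>D. c (T d x) \<noteq> c x + d} \<le> measure M U"
    using U_sets by (rule finite_measure_mono_AE)
  also have "\<dots> \<le> measure M (V r) + measure M (\<Union>d\<in>D. T d -` V r \<inter> space M)"
    unfolding U_def using V_sets flow_vimage_sets[OF V_sets] D
    by (intro measure_Un_le sets.finite_UN) auto
  also have "\<dots> \<le> measure M (V r) + (\<Sum>d\<in>D. measure M (T d -` V r \<inter> space M))"
    using flow_vimage_sets[OF V_sets] D
    by (intro add_left_mono finite_measure_subadditive_finite) auto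
  also have "\<dots> = (card D + 1) * measure M (V r)"
    by (simp add: measure_flow_vimage[OF V_sets] algebra_simps)
  also have "\<dots> \<le> (card D + 1) * (C / R)"
    using r(3) by (intro mult_left_mono) auto
  also have "\<dots> < \<eta>"
    using R R0 \<open>\<eta> > 0\<close> by (simp add: field_simps)
  finally show thesis using that c_simple by blast
qed

end

section \<open>Sweeping out\<close>

text \<open>An upper density gives only infinitely many good \<open>N\<close>; this suffices because
  the ends of the blocks may be chosen among them.\<close>

lemma frequently_dense:
  assumes density: "(\<lambda>K. rel_upper_density s (\<Union>k\<in>{1..K}. S k)) \<longlonglongrightarrow> 1"
    and "\<epsilon> > 0"
  obtains K :: nat where "\<And>m. \<exists>N>m. (1 - \<epsilon>) * real N < card {n \<in> {1..N}. s n \<in> (\<Union>k\<in>{1..K}. S k)}"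
proof -
  have "ereal (1 - \<epsilon>) < 1" using \<open>\<epsilon> > 0\<close> by simp
  from order_tendstoD(1)[OF density this]
  obtain K where K: "ereal (1 - \<epsilon>) < rel_upper_density s (\<Union>k\<in>{1..K}. S k)"
    using eventually_happens trivial_limit_sequentially by blast
  have "\<exists>N>m. (1 - \<epsilon>) * real N < card {n \<in> {1..N}. s n \<in> (\<Union>k\<in>{1..K}. S k)}" for m
  proof (rule ccontr)
    assume "\<not> ?thesis"
    then have "real (card {n \<in> {1..N}. s n \<in> (\<Union>k\<in>{1..K}. S k)}) \<le> (1 - \<epsilon>) * real N" if "N > m" for N
      using that by (meson not_less)
    then have "ereal (real (card {n \<in> {1..N}. s n \<in> (\<Union>k\<in>{1..K}. S k)}) / real N) \<le> ereal (1 - \<epsilon>)"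
      if "N > m" for N
      using that by (simp add: divide_le_eq)
    then have "\<forall>\<^sub>F N in sequentially.
        ereal (real (card {n \<in> {1..N}. s n \<in> (\<Union>k\<in>{1..K}. S k)}) / real N) \<le> ereal (1 - \<epsilon>)"
      by (rule eventually_mono[OF eventually_gt_at_top[of m]])
    then have "rel_upper_density s (\<Union>k\<in>{1..K}. S k) \<le> ereal (1 - \<epsilon>)"
      unfolding rel_upper_density_def by (rule Limsup_bounded)
    with K show False by simp
  qed
  with that show thesis by blast
qed

text \<open>The growth makes everything up to \<open>N j\<close> a negligible part of the first
  \<open>N (Suc j)\<close> terms, so losing all earlier blocks costs only a factor
  \<open>\<delta>\<close>.\<close>

lemma lacunary_sequence:
  fixes P :: "nat \<Rightarrow> bool"
  assumes P: "\<And>m. \<exists>n>m. P n" and "\<delta> > 0"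
  obtains N :: "nat \<Rightarrow> nat" where "N 0 > p" "strict_mono N"
    "\<And>j. real (N j) \<le> \<delta> * real (N (Suc j))" "\<And>j. P (N (Suc j))"
proof -
  have "\<exists>n>m. real m \<le> \<delta> * real n \<and> P n" for m
  proof -
    obtain q :: nat where q: "real m / \<delta> < q" using reals_Archimedean2 by blast
    obtain n where n: "n > max m q" "P n" using P by blast
    from q have "real m \<le> \<delta> * real q" using \<open>\<delta> > 0\<close> by (simp add: divide_less_eq mult.commute)
    also have "\<dots> \<le> \<delta> * real n" using n(1) \<open>\<delta> > 0\<close> by simp
    finally show ?thesis using n by auto
  qed
  then obtain f where f: "\<And>m. f m > m" "\<And>m. real m \<le> \<delta> * real (f m)" "\<And>m. P (f m)"
    by metis
  show thesis
    by (rule that[of "\<lambda>j. (f ^^ j) (Suc p)"]) (use f in \<open>auto simp: strict_mono_Suc_iff\<close>)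
qed

section \<open>The finite stages of sweeping out\<close>

context aperiodic_dynamical_system
begin

lemma partial_sweep:
  fixes s :: "nat \<Rightarrow> real" and S :: "nat \<Rightarrow> real set"
  assumes inj: "inj_on s {1..}"
    and density: "(\<lambda>K. rel_upper_density s (\<Union>k\<in>{1..K}. S k)) \<longlonglongrightarrow> 1"
    and independence: "\<And>k. k \<ge> 1 \<Longrightarrow> rat_independent (S k)"
    and "\<epsilon> > 0"
  shows "\<exists>E\<in>sets M. \<exists>G\<in>sets M. measure M E < \<epsilon> \<and> measure M (space M - G) < \<epsilon> \<and>
    (\<forall>x\<in>G. \<exists>N>p. (1 - \<epsilon>) * real N \<le> (\<Sum>n=1..N. indicator E (T (s n) x)))"
proof -
  obtain K :: nat where
    K: "\<And>m. \<exists>N>m. (1 - \<epsilon> / 2) * real N < card {n \<in> {1..N}. s n \<in> (\<Union>k\<in>{1..K}. S k)}"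
    using frequently_dense[OF density, of "\<epsilon> / 2"] \<open>\<epsilon> > 0\<close> by auto
  obtain N :: "nat \<Rightarrow> nat" where N: "N 0 > p" "strict_mono N"
    "\<And>j. real (N j) \<le> \<epsilon> / 2 * real (N (Suc j))"
    "\<And>j. (1 - \<epsilon> / 2) * real (N (Suc j)) < card {n \<in> {1..N (Suc j)}. s n \<in> (\<Union>k\<in>{1..K}. S k)}"
    using lacunary_sequence[OF K, of "\<epsilon> / 2" p] \<open>\<epsilon> > 0\<close> by auto
  obtain Q :: nat where Q: "real K / \<epsilon> < Q" using reals_Archimedean2 by blast
  have "0 \<le> real K / \<epsilon>" using \<open>\<epsilon> > 0\<close> by simp
  with Q have Q0: "Q > 0" by linarith
  have KQ: "real K / Q < \<epsilon>" using Q Q0 \<open>\<epsilon> > 0\<close> by (simp add: field_simps)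

  define V where "V = ({1..K} \<rightarrow>\<^sub>E {0..<int Q})"
  have "finite V" by (auto simp: V_def intro!: finite_PiE)
  \<comment> \<open>Block \<open>j\<close>, the indices in \<open>{N j<..N (Suc j)}\<close>, serves
    the points with coordinate vector \<open>e j\<close>.\<close>
  then obtain e where e: "bij_betw e {0..<card V} V"
    using ex_bij_betw_nat_finite by blast
  define block where "block n = (LEAST j. n \<le> N (Suc j))" for n
  have block: "block n = j" if "N j < n" "n \<le> N (Suc j)" for n j
    unfolding block_def
  proof (rule Least_equality)
    fix i assume "n \<le> N (Suc i)"
    with that(1) have "N j < N (Suc i)" by simp
    then show "j \<le> i" using strict_mono_less[OF N(2)] by auto
  qed (rule that)
  \<comment> \<open>Injectivity of \<open>s\<close> lets \<open>inv_into\<close> recover the index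
    of a term, and thereby its block.\<close>
  have "\<exists>\<psi>. (\<forall>x y. \<psi> (x + y) = \<psi> x + \<psi> y) \<and>
      (\<forall>x\<in>S k. \<psi> x = - real_of_int (e (block (inv_into {1..} s x)) k))" if "k \<in> {1..K}" for k
    using independence that by (intro rat_independent_additive_extension) simp
  then obtain \<psi> :: "nat \<Rightarrow> real \<Rightarrow> real" where \<psi>:
    "\<And>k x y. k \<in> {1..K} \<Longrightarrow> \<psi> k (x + y) = \<psi> k x + \<psi> k y"
    "\<And>k x. k \<in> {1..K} \<Longrightarrow> x \<in> S k \<Longrightarrow> \<psi> k x = - real_of_int (e (block (inv_into {1..} s x)) k)"
    by metis

  define D where "D = s ` {1..N (card V)}"
  have "finite D" by (simp add: D_def)
  from approximate_clock[OF this \<open>\<epsilon> > 0\<close>] obtain c :: "'a \<Rightarrow> real"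
    where c: "simple_function M c"
      and c_bad: "measure M {x \<in> space M. \<exists>d\<in>D. c (T d x) \<noteq> c x + d} < \<epsilon>"
    by blast
  \<comment> \<open>The value of \<open>\<psi> k\<close> at the clock need not be an integer. The
    floor is harmless, since the terms of a block change that value by an integer.\<close>
  define a where "a k x = \<lfloor>\<psi> k (c x)\<rfloor>" for k x
  define L where "L k u = {x \<in> space M. (u + a k x) mod int Q = 0}" for k u
  have L_sets: "L k u \<in> sets M" for k u
  proof -
    \<comment> \<open>The clock takes finitely many values, so composing it with the possibly
      non-measurable \<open>\<psi> k\<close> causes no trouble.\<close>
    have "simple_function M (a k)"
      unfolding a_def by (rule simple_function_compose1[OF c])
    then have "a k -` {z. (u + z) mod int Q = 0} \<inter> space M \<in> sets M"
      by (rule simple_functionD)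
    then show ?thesis by (simp add: L_def vimage_def Int_def conj_commute)
  qed
  \<comment> \<open>The level sets for the \<open>Q\<close> translations are disjoint.\<close>
  have "\<exists>u. measure M (L k u) \<le> 1 / Q" for k
  proof (rule ccontr)
    assume "\<nexists>u. measure M (L k u) \<le> 1 / Q"
    then have "(\<Sum>u\<in>{0..<int Q}. 1 / real Q) < (\<Sum>u\<in>{0..<int Q}. measure M (L k u))"
      using Q0 by (intro sum_strict_mono) (auto simp: not_le)
    also have "\<dots> = measure M (\<Union>u\<in>{0..<int Q}. L k u)"
    proof (rule finite_measure_finite_Union[symmetric])
      show "disjoint_family_on (L k) {0..<int Q}"
        unfolding disjoint_family_on_def
      proof (intro ballI impI)
        fix u v assume uv: "u \<in> {0..<int Q}" "v \<in> {0..<int Q}" "u \<noteq> v"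
        show "L k u \<inter> L k v = {}"
        proof (rule ccontr)
          assume "L k u \<inter> L k v \<noteq> {}"
          then obtain x where "int Q dvd u + a k x" "int Q dvd v + a k x"
            by (auto simp: L_def)
          then have "int Q dvd (u + a k x) - (v + a k x)" by (rule dvd_diff)
          then have "int Q dvd u - v" by simp
          with uv(3) have "\<bar>int Q\<bar> \<le> \<bar>u - v\<bar>" by (intro dvd_imp_le_int) auto
          with uv(1,2) show False by auto
        qed
      qed
    qed (use L_sets in auto)
    also have "\<dots> \<le> 1" by simp
    finally show False using Q0 by simp
  qed
  then obtain u where u: "\<And>k. measure M (L k (u k)) \<le> 1 / Q" by metis
  define E where "E = (\<Union>k\<in>{1..K}. L k (u k))"
  define G where "G = space M - {x \<in> space M. \<exists>d\<in>D. c (T d x) \<noteq> c x + d}"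
  have E_sets: "E \<in> sets M" unfolding E_def using L_sets by auto
  have "measure M E \<le> (\<Sum>k\<in>{1..K}. measure M (L k (u k)))"
    unfolding E_def using L_sets by (intro finite_measure_subadditive_finite) auto
  also have "\<dots> \<le> (\<Sum>k\<in>{1..K}. 1 / Q)" using u by (intro sum_mono)
  also have "\<dots> < \<epsilon>" using KQ by simp
  finally have E_small: "measure M E < \<epsilon>" .
  have G_sets: "G \<in> sets M"
  proof -
    have c_borel: "c \<in> borel_measurable M" using c by (rule borel_measurable_simple_function)
    have "(\<lambda>x. c (T d x)) \<in> borel_measurable M" for d
      by (rule measurable_compose[OF flow_measurable c_borel])
    then have "{x \<in> space M. c (T d x) \<noteq> c x + d} \<in> sets M" for d
      using c_borel by (intro borel_measurable_neq borel_measurable_add) auto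
    then have "(\<Union>d\<in>D. {x \<in> space M. c (T d x) \<noteq> c x + d}) \<in> sets M"
      using \<open>finite D\<close> by (intro sets.finite_UN) auto
    then have "space M - (\<Union>d\<in>D. {x \<in> space M. c (T d x) \<noteq> c x + d}) \<in> sets M" by auto
    also have "space M - (\<Union>d\<in>D. {x \<in> space M. c (T d x) \<noteq> c x + d}) = G"
      by (auto simp: G_def)
    finally show ?thesis .
  qed
  have G_large: "measure M (space M - G) < \<epsilon>"
  proof -
    have "space M - G = {x \<in> space M. \<exists>d\<in>D. c (T d x) \<noteq> c x + d}" by (auto simp: G_def)
    with c_bad show ?thesis by simp
  qed

  have "\<exists>N>p. (1 - \<epsilon>) * real N \<le> (\<Sum>n=1..N. indicator E (T (s n) x))" if "x \<in> G" for x
  proof -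
    have x: "x \<in> space M" and clock: "\<And>d. d \<in> D \<Longrightarrow> c (T d x) = c x + d"
      using that by (auto simp: G_def)
    \<comment> \<open>The translated coordinates of \<open>x\<close>. Moving by a term of
      \<open>S k\<close> in the matching block subtracts \<open>v k\<close> and makes the
      \<open>k\<close>-th coordinate \<open>0\<close> modulo \<open>Q\<close>.\<close>
    define v where "v = (\<lambda>k\<in>{1..K}. (u k + a k x) mod int Q)"
    have "v \<in> V" using Q0 by (auto simp: V_def v_def)
    then have "v \<in> e ` {0..<card V}" using bij_betw_imp_surj_on[OF e] by simp
    then obtain j where j: "j < card V" "e j = v" by auto
    let ?N = "N (Suc j)"
    have hit: "T (s n) x \<in> E" if n: "N j < n" "n \<le> ?N" and k: "k \<in> {1..K}" "s n \<in> S k" for n k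
    proof -
      have "?N \<le> N (card V)" using j(1) strict_mono_less_eq[OF N(2)] by simp
      then have "s n \<in> D" using n by (auto simp: D_def)
      have "\<psi> k (s n) = - of_int (v k)"
        using \<psi>(2)[OF k] n block[OF n] inv_into_f_f[OF inj, of n] j(2) by simp
      then have "\<psi> k (c (T (s n) x)) = \<psi> k (c x) - of_int (v k)"
        using \<psi>(1)[OF k(1)] clock[OF \<open>s n \<in> D\<close>] by simp
      then have "a k (T (s n) x) = a k x - v k" by (simp add: a_def)
      then have "u k + a k (T (s n) x) = (u k + a k x) - (u k + a k x) mod int Q"
        using k(1) by (simp add: v_def)
      then have "int Q dvd u k + a k (T (s n) x)" by (simp only: dvd_minus_mod)
      then have "T (s n) x \<in> L k (u k)"
        using flow_in_space[OF x] by (simp add: L_def)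
      then show ?thesis using k(1) by (auto simp: E_def)
    qed
    let ?R = "{n \<in> {1..?N}. s n \<in> (\<Union>k\<in>{1..K}. S k)}"
    \<comment> \<open>One half of \<open>\<epsilon>\<close> pays for the terms outside
      \<open>S 1, ..., S K\<close>, the other for the terms before the block.\<close>
    have "(1 - \<epsilon>) * real ?N \<le> real (card ?R) - real (N j)"
      using N(3,4)[of j] by (simp add: algebra_simps)
    also have "\<dots> = real (card ?R) - real (card {1..N j})" by simp
    also have "\<dots> \<le> real (card (?R - {1..N j}))"
      using diff_card_le_card_Diff[of "{1..N j}" ?R] by simp
    also have "\<dots> \<le> real (card {n \<in> {1..?N}. T (s n) x \<in> E})"
      using hit by (intro of_nat_mono card_mono) (auto simp: not_le)
    also have "\<dots> = (\<Sum>n=1..?N. indicator E (T (s n) x))"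
      by (simp add: indicator_def sum.If_cases Int_def)
    finally have "(1 - \<epsilon>) * real ?N \<le> (\<Sum>n=1..?N. indicator E (T (s n) x))" .
    moreover have "p < ?N" using N(1) strict_mono_less[OF N(2), of 0 "Suc j"] by simp
    ultimately show ?thesis by blast
  qed
  with E_sets G_sets E_small G_large show ?thesis by blast
qed

end

section \<open>From finite stages to almost every point\<close>

theorem proposition3p8:
  fixes s :: "nat \<Rightarrow> real" and S :: "nat \<Rightarrow> real set"
  assumes increasing: "strict_mono_on {1..} s"
    and positive: "\<And>n. n \<ge> 1 \<Longrightarrow> s n > 0"
    and union: "s ` {1..} = (\<Union>k\<in>{1..}. S k)"
    and disjoint: "disjoint_family_on S {1..}"
    and density: "(\<lambda>K. rel_upper_density s (\<Union>k\<in>{1..K}. S k)) \<longlonglongrightarrow> 1"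
    and independence: "\<And>k. k \<ge> 1 \<Longrightarrow> rat_independent (S k)"
  shows "strong_sweeping_out TYPE('a) s"
  unfolding strong_sweeping_out_def
proof (intro allI impI)
  fix M :: "'a measure" and T and \<epsilon> :: real
  assume "aperiodic_dynamical_system M T" and "\<epsilon> > 0"
  then interpret aperiodic_dynamical_system M T by simp
  have inj: "inj_on s {1..}" using increasing by (rule strict_mono_on_imp_inj_on)
  \<comment> \<open>The total is at most \<open>\<epsilon> / 2\<close>, which leaves room for the
    strict bound on the union of the \<open>E p\<close>. Summability also serves Borel-Cantelli for
    the complements of the \<open>G p\<close>.\<close>
  define \<delta> :: "nat \<Rightarrow> real" where "\<delta> p = min 1 (\<epsilon> / 2) * (1 / 2) ^ Suc p" for p
  have \<delta>_pos: "\<delta> p > 0" for p using \<open>\<epsilon> > 0\<close> by (simp add: \<delta>_def)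
  have \<delta>_sums: "\<delta> sums min 1 (\<epsilon> / 2)"
    unfolding \<delta>_def using sums_mult[OF power_half_series] by simp
  define sweeps where "sweeps p E G \<longleftrightarrow> measure M E < \<delta> p \<and> measure M (space M - G) < \<delta> p \<and>
      (\<forall>x\<in>G. \<exists>N>p. (1 - \<delta> p) * real N \<le> (\<Sum>n=1..N. indicator E (T (s n) x)))" for p E G
  have "\<exists>E\<in>sets M. \<exists>G\<in>sets M. sweeps p E G" for p
    unfolding sweeps_def by (rule partial_sweep[OF inj density independence \<delta>_pos])
  then obtain E G where EG_sets: "\<And>p. E p \<in> sets M" "\<And>p. G p \<in> sets M"
    and sweeps: "\<And>p. sweeps p (E p) (G p)"
    by metis
  have E: "measure M (E p) < \<delta> p" and G: "measure M (space M - G p) < \<delta> p" for p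
    using sweeps[of p] by (simp_all add: sweeps_def)
  have E_summable: "summable (\<lambda>p. measure M (E p))"
    by (rule summable_comparison_test'[OF sums_summable[OF \<delta>_sums], where N = 0])
      (simp add: less_imp_le[OF E])
  have "measure M (\<Union>p. E p) \<le> (\<Sum>p. measure M (E p))"
    using EG_sets(1) E_summable by (intro finite_measure_subadditive_countably) auto
  also have "\<dots> \<le> (\<Sum>p. \<delta> p)"
    by (rule suminf_le[OF less_imp_le[OF E] E_summable sums_summable[OF \<delta>_sums]])
  also have "\<dots> < \<epsilon>" using sums_unique[OF \<delta>_sums] \<open>\<epsilon> > 0\<close> by simp
  finally have small: "measure M (\<Union>p. E p) < \<epsilon>" .

  have "AE x in M. \<forall>\<^sub>F p in sequentially. x \<in> space M - (space M - G p)"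
  proof (rule borel_cantelli_AE1)
    show "summable (\<lambda>p. measure M (space M - G p))"
      by (rule summable_comparison_test'[OF sums_summable[OF \<delta>_sums], where N = 0])
        (simp add: less_imp_le[OF G])
  qed (use EG_sets(2) in \<open>auto simp: emeasure_eq_measure\<close>)
  then have "AE x in M. limsup (\<lambda>N. ereal ((\<Sum>n=1..N. indicator (\<Union>p. E p) (T (s n) x)) / real N)) \<ge> 1"
  proof eventually_elim
    case (elim x)
    let ?A = "\<lambda>N. (\<Sum>n=1..N. indicator (\<Union>p. E p) (T (s n) x)) / real N"
    show "1 \<le> limsup (\<lambda>N. ereal (?A N))"
    \<comment> \<open>If the averages stayed below some \<open>r < 1\<close> from \<open>m\<close>
      on, a stage \<open>p\<close> beyond \<open>m\<close> with \<open>x\<close> in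
      \<open>G p\<close> and \<open>\<delta> p < 1 - r\<close> would give an \<open>N > p\<close>
      whose average exceeds \<open>r\<close>.\<close>
    proof (rule ccontr)
      assume "\<not> 1 \<le> limsup (\<lambda>N. ereal (?A N))"
      then have "limsup (\<lambda>N. ereal (?A N)) < 1" by simp
      then obtain r where r: "limsup (\<lambda>N. ereal (?A N)) < ereal r" "ereal r < 1"
        using ereal_dense2 by blast
      have "\<forall>\<^sub>F N in sequentially. ?A N < r"
        using Limsup_lessD[OF r(1)] by simp
      then obtain m where m: "\<And>N. N \<ge> m \<Longrightarrow> ?A N < r"
        by (auto simp: eventually_sequentially)
      have "\<delta> \<longlonglongrightarrow> 0" using \<delta>_sums by (intro summable_LIMSEQ_zero sums_summable)
      then have "\<forall>\<^sub>F p in sequentially. \<delta> p < 1 - r"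
        using r(2) by (intro order_tendstoD) auto
      with elim eventually_ge_at_top[of m]
      have "\<forall>\<^sub>F p in sequentially. x \<in> G p \<and> m \<le> p \<and> \<delta> p < 1 - r"
        by eventually_elim auto
      then obtain p where p: "x \<in> G p" "m \<le> p" "\<delta> p < 1 - r"
        using eventually_happens trivial_limit_sequentially by blast
      obtain N where N: "N > p" "(1 - \<delta> p) * real N \<le> (\<Sum>n=1..N. indicator (E p) (T (s n) x))"
        using sweeps[of p] p(1) unfolding sweeps_def by blast
      have "r * real N < (1 - \<delta> p) * real N"
        using p(3) N(1) by (intro mult_strict_right_mono) auto
      also have "\<dots> \<le> (\<Sum>n=1..N. indicator (\<Union>p. E p) (T (s n) x))"
        by (rule order_trans[OF N(2)], rule sum_mono) (auto simp: indicator_def)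
      finally have "r < ?A N" using N(1) by (simp add: less_divide_eq)
      with m[of N] p(2) N(1) show False by simp
    qed
  qed
  with small EG_sets(1) show "\<exists>E\<in>sets M. measure M E < \<epsilon> \<and>
      (AE x in M. limsup (\<lambda>N. ereal ((\<Sum>n=1..N. indicator E (T (s n) x)) / real N)) \<ge> 1)"
    by (intro bexI[of _ "\<Union>p. E p"]) auto
qed

end
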